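(* For every integer $k\ge 4$, $\tilde{r}(P_3,P_3,C_{4k+1}) \le 6k+3$.
   Context: $P_m$ denotes the path and $C_m$ the cycle on $m$ vertices. The three-color online Ramsey game for graphs $G_1,G_2,G_3$ is played by Builder and Painter on an infinite vertex set with initially no edges. In each round Builder draws an edge between two currently nonadjacent vertices, and Painter immediately colors it red, blue or green. Builder wins once the colored graph contains a red copy of $G_1$, a blue copy of $G_2$, or a green copy of $G_3$. The online Ramsey number $\tilde{r}(G_1,G_2,G_3)$ is the minimum number of rounds within which Builder can guarantee a win against every strategy of Painter. *)

theory Defs
  imports Main "HOL-Library.Extended_Nat"
begin

text \<open>Graphs are pairs of a vertex set and a set of edges, an edge being a two-element set
  of vertices.\<close>

type_synonym 'a graph = "'a set \<times> 'a set set"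

definition path_graph :: "nat \<Rightarrow> nat graph" where
  "path_graph m = ({..<m}, {{i, Suc i} | i. Suc i < m})"

text \<open>A cycle in the usual sense only for \<open>m \<ge> 3\<close>.\<close>

definition cycle_graph :: "nat \<Rightarrow> nat graph" where
  "cycle_graph m = ({..<m}, {{i, Suc i mod m} | i. i < m})"

text \<open>Copies are subgraphs, not necessarily induced.\<close>

definition contains_copy :: "'v set set \<Rightarrow> 'a graph \<Rightarrow> bool" where
  "contains_copy F G \<longleftrightarrow> (\<exists>f. inj_on f (fst G) \<and> (\<forall>e\<in>snd G. f ` e \<in> F))"

datatype color = Red | Blue | Green

text \<open>The board has vertex set \<^typ>\<open>nat\<close>. A position is the list of all edges drawn so far, in
  the order in which they were drawn, each with the color it received.\<close>

type_synonym position = "(nat set \<times> color) list"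
type_synonym builder = "position \<Rightarrow> nat set"
type_synonym painter = "position \<Rightarrow> nat set \<Rightarrow> color"

definition color_class :: "position \<Rightarrow> color \<Rightarrow> nat set set" where
  "color_class h c = {e. (e, c) \<in> set h}"

text \<open>Only finitely many edges have been drawn in a position, so there is always a legal move and
  legality may be demanded at all positions, reachable or not.\<close>

definition legal_builder :: "builder \<Rightarrow> bool" where
  "legal_builder B \<longleftrightarrow> (\<forall>h. (\<exists>u v. u \<noteq> v \<and> B h = {u, v}) \<and> B h \<notin> fst ` set h)"

primrec play :: "builder \<Rightarrow> painter \<Rightarrow> nat \<Rightarrow> position" where
  "play B P 0 = []"
| "play B P (Suc n) = (let h = play B P n; e = B h in h @ [(e, P h e)])"

definition builder_won :: "'a graph \<Rightarrow> 'b graph \<Rightarrow> 'c graph \<Rightarrow> position \<Rightarrow> bool" where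
  "builder_won G1 G2 G3 h \<longleftrightarrow>
     contains_copy (color_class h Red) G1 \<or>
     contains_copy (color_class h Blue) G2 \<or>
     contains_copy (color_class h Green) G3"

definition builder_wins_within :: "'a graph \<Rightarrow> 'b graph \<Rightarrow> 'c graph \<Rightarrow> nat \<Rightarrow> bool" where
  "builder_wins_within G1 G2 G3 n \<longleftrightarrow>
     (\<exists>B. legal_builder B \<and> (\<forall>P. \<exists>m\<le>n. builder_won G1 G2 G3 (play B P m)))"

text \<open>The infimum is \<open>\<infinity>\<close> if Builder cannot force a win within any bounded number of rounds.\<close>

definition online_ramsey :: "'a graph \<Rightarrow> 'b graph \<Rightarrow> 'c graph \<Rightarrow> enat" where
  "online_ramsey G1 G2 G3 = Inf {enat n | n. builder_wins_within G1 G2 G3 n}"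

end

theory Submission
  imports Defs
begin

text \<open>
  Merge red and blue into one graph \<open>H\<close>. A vertex with two edges in \<open>H\<close> is saturated: every further
  edge at it must become green, since a third edge in \<open>H\<close> would create a monochromatic \<open>P\<^sub>3\<close>. An edge
  of \<open>H\<close> half-saturates both of its endpoints, so it pays for one saturated vertex and thus for two
  forced green edges. A cycle of length \<open>l = 2 m + 1\<close> then costs about \<open>3 l / 2\<close> rounds, provided that
  saturated vertices never become neighbors on the green path and half-saturated vertices are used up.

  Builder grows a green path. As soon as one end is saturated it serves as root, and closing the path
  at the right length is forced. The other end is extended by fresh and half-saturated vertices such
  that each answer of Painter preserves a linear bound on \<open>|H|\<close>. As long as Painter refuses to saturate
  an end of the path, at least three green edges are gained per edge of \<open>H\<close>; if this lasts until the path
  has length \<open>l\<close>, enough rounds are left (here \<open>m \<ge> 8\<close> is used) to close it by two crossing chords.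
\<close>

section \<open>The color-blind game\<close>

text \<open>\<open>H\<close> collects the red and blue edges, \<open>G\<close> the green ones: a vertex with three edges in \<open>H\<close> has
  two of the same color.\<close>

inductive win :: "nat \<Rightarrow> nat \<Rightarrow> nat set set \<Rightarrow> nat set set \<Rightarrow> bool" for l :: nat where
  star: "\<lbrakk>a \<noteq> b; a \<noteq> c; b \<noteq> c; {v, a} \<in> H; {v, b} \<in> H; {v, c} \<in> H\<rbrakk> \<Longrightarrow> win l n H G"
| cycle: "contains_copy G (cycle_graph l) \<Longrightarrow> win l n H G"
| move: "\<lbrakk>u \<noteq> v; {u, v} \<notin> H; {u, v} \<notin> G; win l n (insert {u, v} H) G; win l n H (insert {u, v} G)\<rbrakk>
    \<Longrightarrow> win l (Suc n) H G"

definition saturated :: "nat set set \<Rightarrow> nat \<Rightarrow> bool" where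
  "saturated H v \<longleftrightarrow> (\<exists>a b. a \<noteq> b \<and> {v, a} \<in> H \<and> {v, b} \<in> H)"

definition half :: "nat set set \<Rightarrow> nat \<Rightarrow> bool" where
  "half H v \<longleftrightarrow> (\<exists>!a. {v, a} \<in> H)"

lemma win_moveI:
  assumes "0 < n" "u \<noteq> v" "{u, v} \<notin> H" "{u, v} \<notin> G"
    "win l (n - 1) (insert {u, v} H) G" "win l (n - 1) H (insert {u, v} G)"
  shows "win l n H G"
  using win.move[of u v H G l "n - 1"] assms by simp

text \<open>A third edge of \<open>H\<close> at \<open>u\<close> ends the game by
  \<open>star\<close>, however few rounds are left, so only the green answer has to be played
  on.\<close>

lemma win_forcedI:
  assumes "0 < n" "saturated H u" "u \<noteq> v" "{u, v} \<notin> H" "{u, v} \<notin> G"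
    "win l (n - 1) H (insert {u, v} G)"
  shows "win l n H G"
proof (rule win_moveI[of n u v])
  obtain a b where "a \<noteq> b" "{u, a} \<in> H" "{u, b} \<in> H"
    using assms(2) unfolding saturated_def by blast
  then show "win l (n - 1) (insert {u, v} H) G"
    using assms(4) by (intro win.star[of a b v u]) auto
qed (use assms in auto)

section \<open>Saturated and half-saturated vertices as edges are added\<close>

lemma saturated_insert: "saturated H v \<Longrightarrow> saturated (insert e H) v"
  unfolding saturated_def by blast

lemma saturated_insert_half:
  assumes "half H v" "{v, w} \<notin> H"
  shows "saturated (insert {v, w} H) v" "saturated (insert {w, v} H) v"
  using assms unfolding half_def saturated_def by (metis insertCI insert_commute)+

lemma half_insert_new:
  assumes "v \<notin> \<Union>H" "v \<noteq> w"
  shows "half (insert {v, w} H) v" "half (insert {w, v} H) v"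
  using assms unfolding half_def by (auto simp: doubleton_eq_iff intro!: ex1I[of _ w])

lemma half_insert_other:
  assumes "half H v" "v \<noteq> a" "v \<noteq> b"
  shows "half (insert {a, b} H) v"
  using assms unfolding half_def by (auto simp: doubleton_eq_iff)

lemma half_in: "half H v \<Longrightarrow> v \<in> \<Union>H"
  unfolding half_def by blast

lemma saturated_in: "saturated H v \<Longrightarrow> v \<in> \<Union>H"
  unfolding saturated_def by blast

lemma not_in_edges: "v \<notin> \<Union>H \<Longrightarrow> {v, w} \<notin> H" "v \<notin> \<Union>H \<Longrightarrow> {w, v} \<notin> H"
  by blast+

lemma fresh_vertex:
  assumes "finite (\<Union>H)" "finite A"
  obtains z :: nat where "z \<notin> \<Union>H" "z \<notin> A"
  using ex_new_if_finite[of "\<Union>H \<union> A"] assms by auto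

section \<open>Green paths and their closing\<close>

fun pedges :: "nat list \<Rightarrow> nat set set" where
  "pedges (x # y # p) = insert {x, y} (pedges (y # p))"
| "pedges _ = {}"

lemma pedges_Cons: "p \<noteq> [] \<Longrightarrow> pedges (x # p) = insert {x, hd p} (pedges p)"
  by (cases p) auto

lemma pedges_snoc: "p \<noteq> [] \<Longrightarrow> pedges (p @ [x]) = insert {last p, x} (pedges p)"
  by (induction p rule: pedges.induct) (auto simp: insert_commute)

lemma pedges_append:
  "p \<noteq> [] \<Longrightarrow> q \<noteq> [] \<Longrightarrow> pedges (p @ q) = pedges p \<union> insert {last p, hd q} (pedges q)"
  by (induction p rule: pedges.induct) (auto simp: pedges_Cons)

lemma pedges_rev: "pedges (rev p) = pedges p"
proof (induction p)
  case (Cons x p)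
  then show ?case
    by (cases "p = []") (auto simp: pedges_snoc pedges_Cons last_rev insert_commute)
qed simp

lemma pedges_subset: "e \<in> pedges p \<Longrightarrow> e \<subseteq> set p"
  by (induction p rule: pedges.induct) auto

lemma not_in_pedges: "v \<notin> set p \<Longrightarrow> {v, w} \<notin> pedges p" "v \<notin> set p \<Longrightarrow> {w, v} \<notin> pedges p"
  using pedges_subset by blast+

lemma pedges_nth: "Suc i < length p \<Longrightarrow> {p ! i, p ! Suc i} \<in> pedges p"
proof (induction p arbitrary: i rule: pedges.induct)
  case (1 x y p)
  then show ?case by (cases i) auto
qed auto

text \<open>On two vertices the closing edge would be the path itself.\<close>

lemma hd_last_not_in_pedges:
  assumes "distinct p" "3 \<le> length p"
  shows "{hd p, last p} \<notin> pedges p"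
proof -
  obtain x y z q where p: "p = x # y # z # q"
    using assms(2) by (auto simp: Suc_le_length_iff numeral_eq_Suc)
  have "last p \<in> set (z # q)" unfolding p by (simp add: last_in_set)
  moreover have "x \<notin> set (y # z # q)" "y \<notin> set (z # q)" using assms(1) p by auto
  ultimately show ?thesis
    using not_in_pedges(1)[of x "y # z # q"] unfolding p by (auto simp: doubleton_eq_iff)
qed

text \<open>An inclusion in \<open>G\<close> suffices, so the lemma also covers reroutings that
  abandon some green path edges.\<close>

lemma win_cycle:
  assumes "distinct p" "length p = l" "3 \<le> l" "pedges p \<subseteq> G" "{hd p, last p} \<in> G"
  shows "win l n H G"
proof (rule win.cycle)
  have "(!) p ` {i, Suc i mod l} \<in> G" if "i < l" for i
  proof (cases "Suc i = l")
    case True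
    then have "p ! i = last p" "p ! 0 = hd p" using assms(2,3)
      by (auto simp: last_conv_nth hd_conv_nth simp flip: length_greater_0_conv)
    then show ?thesis using True assms(5) by (simp add: insert_commute)
  next
    case False
    then show ?thesis using that assms(2,4) pedges_nth[of i p] by auto
  qed
  moreover have "inj_on ((!) p) {..<l}"
    using assms(1,2) by (simp add: inj_on_nth)
  ultimately show "contains_copy G (cycle_graph l)"
    unfolding contains_copy_def cycle_graph_def by (intro exI[of _ "(!) p"]) auto
qed

lemma win_close_path:
  assumes "distinct p" "length p = l" "3 \<le> l" "saturated H (last p)" "{hd p, last p} \<notin> H" "0 < n"
  shows "win l n H (pedges p)"
proof (rule win_forcedI[of n H "last p" "hd p"])
  show "last p \<noteq> hd p"
    using assms(1-3) by (cases p) (auto split: if_splits)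
  show "win l (n - 1) H (insert {last p, hd p} (pedges p))"
    by (rule win_cycle[OF assms(1-3)]) (auto simp: insert_commute)
  show "{last p, hd p} \<notin> pedges p" "{last p, hd p} \<notin> H"
    using hd_last_not_in_pedges[of p] assms by (simp_all add: insert_commute)
qed (use assms in auto)

text \<open>The basic test of the head: the edge to a fresh vertex is always legal, and each refusal
  to color it green brings the head closer to saturation. \<open>A\<close> collects reserve vertices
  to stay clear of.\<close>

lemma win_extend:
  assumes "finite (\<Union>H)" "finite A" "distinct p" "p \<noteq> []" "0 < n"
    and H: "\<And>z. z \<notin> \<Union>H \<Longrightarrow> z \<notin> set p \<Longrightarrow> z \<notin> A \<Longrightarrow> win l (n - 1) (insert {hd p, z} H) (pedges p)"
    and G: "\<And>z. z \<notin> \<Union>H \<Longrightarrow> z \<notin> set p \<Longrightarrow> z \<notin> A \<Longrightarrow> win l (n - 1) H (pedges (z # p))"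
  shows "win l n H (pedges p)"
proof -
  obtain z where z: "z \<notin> \<Union>H" "z \<notin> set p \<union> A"
    using fresh_vertex[of H "set p \<union> A"] assms(1,2) by auto
  show ?thesis
  proof (rule win_moveI[of n "hd p" z])
    show "hd p \<noteq> z" using z(2) assms(4) by auto
    show "win l (n - 1) H (insert {hd p, z} (pedges p))"
      using G[of z] z assms(4) by (simp add: pedges_Cons insert_commute)
  qed (use z assms in \<open>auto simp: not_in_edges not_in_pedges\<close>)
qed

lemma win_extend_forced:
  assumes "finite (\<Union>H)" "finite A" "distinct p" "p \<noteq> []" "0 < n" "saturated H (hd p)"
    and G: "\<And>z. z \<notin> \<Union>H \<Longrightarrow> z \<notin> set p \<Longrightarrow> z \<notin> A \<Longrightarrow> win l (n - 1) H (pedges (z # p))"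
  shows "win l n H (pedges p)"
proof (rule win_extend[OF assms(1-5) _ G])
  fix z assume "z \<notin> \<Union>H"
  moreover obtain a b where "a \<noteq> b" "{hd p, a} \<in> H" "{hd p, b} \<in> H"
    using assms(6) unfolding saturated_def by blast
  ultimately show "win l (n - 1) (insert {hd p, z} H) (pedges p)"
    by (intro win.star[of a b z "hd p"]) auto
qed

section \<open>Endgames for a rooted path at most two vertices short\<close>

definition rooted :: "nat set set \<Rightarrow> nat list \<Rightarrow> bool" where
  "rooted H p \<longleftrightarrow> finite (\<Union>H) \<and> distinct p \<and> p \<noteq> [] \<and> saturated H (last p)"

lemma rooted_insert: "rooted H p \<Longrightarrow> rooted (insert {a, b} H) p"
  unfolding rooted_def by (auto simp: saturated_insert)

lemma rooted_Cons: "rooted H p \<Longrightarrow> z \<notin> set p \<Longrightarrow> rooted H (z # p)"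
  unfolding rooted_def by auto

text \<open>A head untouched by \<open>H\<close> ensures that the closing edge is still undrawn; the
  root forces it to be green.\<close>

lemma win_free_end_missing_0:
  assumes "rooted H p" "hd p \<notin> \<Union>H" "length p = l" "3 \<le> l" "1 \<le> n"
  shows "win l n H (pedges p)"
  using assms unfolding rooted_def by (intro win_close_path) (auto simp: not_in_edges)

lemma win_saturated_end_missing_1:
  assumes "rooted H p" "saturated H (hd p)" "length p + 1 = l" "3 \<le> l" "2 \<le> n"
  shows "win l n H (pedges p)"
proof (rule win_extend_forced[of H "{}"])
  fix z assume "z \<notin> \<Union>H" "z \<notin> set p"
  then show "win l (n - 1) H (pedges (z # p))"
    using assms by (intro win_free_end_missing_0) (auto simp: rooted_Cons)
qed (use assms in \<open>auto simp: rooted_def\<close>)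

text \<open>The worst case is two refusals: they saturate the head, and a forced extension and a
  forced closing remain.\<close>

lemma win_free_end_missing_1:
  assumes "rooted H p" "hd p \<notin> \<Union>H" "length p + 1 = l" "3 \<le> l" "4 \<le> n"
  shows "win l n H (pedges p)"
proof (rule win_extend[of H "{}"])
  fix z assume z: "z \<notin> \<Union>H" "z \<notin> set p"
  then show "win l (n - 1) H (pedges (z # p))"
    using assms by (intro win_free_end_missing_0) (auto simp: rooted_Cons)
  let ?H = "insert {hd p, z} H"
  have zp: "hd p \<noteq> z" using z assms(1) by (auto simp: rooted_def)
  show "win l (n - 1) ?H (pedges p)"
  proof (rule win_extend[of ?H "{}"])
    fix w assume w: "w \<notin> \<Union>?H" "w \<notin> set p"
    then show "win l (n - 1 - 1) ?H (pedges (w # p))"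
      using assms by (intro win_free_end_missing_0) (auto simp: rooted_Cons rooted_insert)
    have "half ?H (hd p)" using half_insert_new(1)[OF assms(2) zp] .
    then have "saturated (insert {hd p, w} ?H) (hd p)"
      by (rule saturated_insert_half) (rule not_in_edges[OF w(1)])
    then show "win l (n - 1 - 1) (insert {hd p, w} ?H) (pedges p)"
      using assms by (intro win_saturated_end_missing_1) (auto simp: rooted_insert)
  qed (use assms in \<open>auto simp: rooted_def\<close>)
qed (use assms in \<open>auto simp: rooted_def\<close>)

text \<open>Both answers to an edge from \<open>g\<close> to a fresh \<open>x\<close> help: in
  \<open>H\<close> it saturates \<open>g\<close>, which is then linked to the head through a free
  vertex; green, it supplies both missing vertices. Nonadjacency keeps the closing edge at
  \<open>g\<close> available.\<close>

lemma win_saturated_end_missing_2_nonadjacent: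
  assumes "rooted H p" "saturated H (hd p)" "length p + 2 = l" "3 \<le> l" "4 \<le> n"
    and g: "half H g" "g \<notin> set p" "{g, last p} \<notin> H"
  shows "win l n H (pedges p)"
proof -
  have fin: "finite (\<Union>H)" and p: "p \<noteq> []" "distinct p" "hd p \<in> set p" "last p \<in> set p"
    using assms(1) by (auto simp: rooted_def)
  obtain x where x: "x \<notin> \<Union>H" "x \<notin> set p" "x \<noteq> g"
    using fresh_vertex[of H "insert g (set p)"] fin by auto
  let ?H = "insert {g, x} H"
  show ?thesis
  proof (rule win_moveI[of n g x])
    have sg: "saturated ?H g"
      by (rule saturated_insert_half[OF g(1)]) (rule not_in_edges[OF x(1)])
    show "win l (n - 1) ?H (pedges p)"
    proof (rule win_extend_forced[of ?H "{g}"])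
      fix z assume z: "z \<notin> \<Union>?H" "z \<notin> set p" "z \<notin> {g}"
      show "win l (n - 1 - 1) ?H (pedges (z # p))"
      proof (rule win_forcedI[of _ _ g z])
        show "{g, z} \<notin> ?H" using z by blast
        show "{g, z} \<notin> pedges (z # p)" using g(2) z(3) by (intro not_in_pedges) auto
        have "win l (n - 1 - 1 - 1) ?H (pedges (g # z # p))"
          using assms p x z by (intro win_close_path) (auto simp: rooted_def saturated_insert doubleton_eq_iff)
        then show "win l (n - 1 - 1 - 1) ?H (insert {g, z} (pedges (z # p)))" by simp
      qed (use sg assms z in auto)
    qed (use assms p fin in \<open>auto simp: saturated_insert\<close>)
    have e: "insert {hd p, x} (insert {g, x} (pedges p)) = pedges (g # x # p)"
      using p by (auto simp: pedges_Cons insert_commute)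
    show "win l (n - 1) H (insert {g, x} (pedges p))"
    proof (rule win_forcedI[of _ _ "hd p" x])
      show "win l (n - 1 - 1) H (insert {hd p, x} (insert {g, x} (pedges p)))"
        unfolding e using assms p x by (intro win_close_path) (auto simp: rooted_def)
      show "{hd p, x} \<notin> insert {g, x} (pedges p)"
        using p x g(2) not_in_pedges(2)[OF x(2)] by (auto simp: doubleton_eq_iff)
    qed (use assms p x in \<open>auto simp: not_in_edges\<close>)
  qed (use assms x g not_in_pedges(2)[OF x(2)] in \<open>auto simp: not_in_edges\<close>)
qed

text \<open>Either end can serve as root, and the single edge of \<open>H\<close> at
  \<open>g\<close> blocks the closing edge at only one of them.\<close>

lemma win_saturated_end_missing_2:
  assumes "rooted H p" "saturated H (hd p)" "length p + 2 = l" "4 \<le> l" "4 \<le> n"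
    and g: "half H g" "g \<notin> set p"
  shows "win l n H (pedges p)"
proof (cases "{g, last p} \<in> H")
  case False
  then show ?thesis using win_saturated_end_missing_2_nonadjacent[of H p l n g] assms by simp
next
  case True
  have "hd p \<noteq> last p"
    using assms(1,3,4) by (cases p) (auto simp: rooted_def split: if_splits)
  then have "{g, hd p} \<notin> H" using True g(1) unfolding half_def by blast
  then have "win l n H (pedges (rev p))"
    using assms by (intro win_saturated_end_missing_2_nonadjacent)
      (auto simp: rooted_def hd_rev last_rev)
  then show ?thesis by (simp add: pedges_rev)
qed

lemma win_free_end_missing_2:
  assumes "rooted H p" "hd p \<notin> \<Union>H" "length p + 2 = l" "4 \<le> l" "6 \<le> n"
  shows "win l n H (pedges p)"
proof (rule win_extend[of H "{}"])
  fix z assume z: "z \<notin> \<Union>H" "z \<notin> set p"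
  then show "win l (n - 1) H (pedges (z # p))"
    using assms by (intro win_free_end_missing_1) (auto simp: rooted_Cons)
  let ?H = "insert {hd p, z} H"
  have zp: "hd p \<noteq> z" using z assms(1) by (auto simp: rooted_def)
  show "win l (n - 1) ?H (pedges p)"
  proof (rule win_extend[of ?H "{}"])
    fix w assume w: "w \<notin> \<Union>?H" "w \<notin> set p"
    then show "win l (n - 1 - 1) ?H (pedges (w # p))"
      using assms by (intro win_free_end_missing_1) (auto simp: rooted_Cons rooted_insert)
    have "half ?H (hd p)" using half_insert_new(1)[OF assms(2) zp] .
    then have "saturated (insert {hd p, w} ?H) (hd p)"
      by (rule saturated_insert_half) (rule not_in_edges[OF w(1)])
    moreover have "half (insert {hd p, w} ?H) z"
      using z w zp by (intro half_insert_other half_insert_new(2)) auto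
    ultimately show "win l (n - 1 - 1) (insert {hd p, w} ?H) (pedges p)"
      using assms z by (intro win_saturated_end_missing_2[of _ _ _ _ z]) (auto simp: rooted_insert)
  qed (use assms in \<open>auto simp: rooted_def\<close>)
qed (use assms in \<open>auto simp: rooted_def\<close>)

text \<open>Recycling \<open>j\<close> saves a round against \<open>win_free_end_missing_2\<close>:
  a refused edge from the head to \<open>j\<close> saturates \<open>j\<close> and half-saturates the
  head at once. This round pays for the debt \<open>c = 1\<close>.\<close>

lemma win_free_end_missing_2_nonadjacent:
  assumes "rooted H p" "hd p \<notin> \<Union>H" "length p + 2 = l" "4 \<le> l" "5 \<le> n"
    and j: "half H j" "j \<notin> set p" "{j, last p} \<notin> H"
  shows "win l n H (pedges p)"
proof (rule win_moveI[of n "hd p" j])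
  have fin: "finite (\<Union>H)" and p: "p \<noteq> []" "distinct p" "hd p \<in> set p" "last p \<in> set p"
    and sr: "saturated H (last p)"
    using assms(1) by (auto simp: rooted_def)
  have hl: "hd p \<noteq> last p" using assms(2) saturated_in[OF sr] by auto
  show hj: "hd p \<noteq> j" using p j by auto
  show "{hd p, j} \<notin> pedges p" using j(2) by (rule not_in_pedges)
  show nH: "{hd p, j} \<notin> H" using assms(2) by blast
  let ?H = "insert {hd p, j} H"
  have sj: "saturated ?H j"
    using saturated_insert_half(2)[OF j(1), of "hd p"] nH by (simp add: insert_commute)
  have hp: "half ?H (hd p)" using half_insert_new(1)[OF assms(2) hj] .
  show "win l (n - 1) ?H (pedges p)"
  proof (rule win_extend[of ?H "{j}"])
    fix g assume g: "g \<notin> \<Union>?H" "g \<notin> set p" "g \<notin> {j}"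
    show "win l (n - 1 - 1) ?H (pedges (g # p))"
    proof (rule win_forcedI[of _ _ j g])
      show "{j, g} \<notin> ?H" using g by blast
      show "{j, g} \<notin> pedges (g # p)" using j(2) g(3) by (intro not_in_pedges) auto
      have "win l (n - 1 - 1 - 1) ?H (pedges (j # g # p))"
        using assms p hl g sr by (intro win_close_path) (auto simp: saturated_insert doubleton_eq_iff)
      then show "win l (n - 1 - 1 - 1) ?H (insert {j, g} (pedges (g # p)))" by simp
    qed (use sj assms g in auto)
    let ?K = "insert {hd p, g} ?H"
    have sh: "saturated ?K (hd p)" using hp g by (intro saturated_insert_half) auto
    show "win l (n - 1 - 1) ?K (pedges p)"
    proof (rule win_extend_forced[of ?K "{j}"])
      fix z assume z: "z \<notin> \<Union>?K" "z \<notin> set p" "z \<notin> {j}"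
      show "win l (n - 1 - 1 - 1) ?K (pedges (z # p))"
      proof (rule win_forcedI[of _ _ j z])
        show "{j, z} \<notin> ?K" using z by blast
        show "{j, z} \<notin> pedges (z # p)" using j(2) z(3) by (intro not_in_pedges) auto
        have "win l (n - 1 - 1 - 1 - 1) ?K (pedges (j # z # p))"
          using assms p hl z sr g by (intro win_close_path) (auto simp: saturated_insert doubleton_eq_iff)
        then show "win l (n - 1 - 1 - 1 - 1) ?K (insert {j, z} (pedges (z # p)))" by simp
      qed (use sj assms z in \<open>auto simp: saturated_insert\<close>)
    qed (use assms p fin sh in auto)
  qed (use assms p fin in auto)
  have e: "insert {hd p, j} (pedges p) = pedges (j # p)"
    using p by (simp add: pedges_Cons insert_commute)
  show "win l (n - 1) H (insert {hd p, j} (pedges p))"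
    unfolding e
  proof (rule win_extend[of H "{}"])
    fix w assume w: "w \<notin> \<Union>H" "w \<notin> set (j # p)"
    show "win l (n - 1 - 1) H (pedges (w # j # p))"
      using assms w by (intro win_free_end_missing_0) (auto simp: rooted_Cons)
    have "saturated (insert {j, w} H) j"
      by (rule saturated_insert_half[OF j(1)]) (rule not_in_edges[OF w(1)])
    then show "win l (n - 1 - 1) (insert {hd (j # p), w} H) (pedges (j # p))"
      using assms by (intro win_saturated_end_missing_1) (auto simp: rooted_insert rooted_Cons)
  qed (use assms p fin in auto)
qed (use assms in auto)

section \<open>Paths with a saturated root\<close>

text \<open>The last vertex of the path \<open>p\<close> is its saturated root and its head is the end being extended;
  \<open>js\<close> are vertices off the path with one edge in \<open>H\<close>, which will be recycled. The thresholds below say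
  that \<open>2 |H| \<le> V - 1 + |js| + c\<close> if the head has no edge in \<open>H\<close>, and \<open>2 |H| \<le> V + 1 + |js| + c\<close> if
  the head is saturated, where \<open>V\<close> is the length of the path and \<open>|H| + (V - 1) + n = 3 m + 3\<close>. One
  unit of debt \<open>c\<close> is affordable if no vertex of \<open>js\<close> is joined to the root in \<open>H\<close>.\<close>

definition board :: "nat set set \<Rightarrow> nat list \<Rightarrow> nat list \<Rightarrow> nat \<Rightarrow> bool" where
  "board H p js c \<longleftrightarrow> finite (\<Union>H) \<and> distinct (p @ js) \<and> p \<noteq> [] \<and> saturated H (last p) \<and>
     (\<forall>j\<in>set js. half H j) \<and> (c = 0 \<or> c = 1 \<and> (\<forall>j\<in>set js. {last p, j} \<notin> H))"

definition free_end_wins :: "nat \<Rightarrow> nat \<Rightarrow> bool" where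
  "free_end_wins m V \<longleftrightarrow> (\<forall>H p js c n. board H p js c \<and> hd p \<notin> \<Union>H \<and> length p = V \<and>
     (length js \<le> 1 \<or> length js = 2 \<and> V + 2 \<le> 2 * m) \<and> 6 * m + 9 \<le> 2 * n + 3 * V + length js + c
     \<longrightarrow> win (2 * m + 1) n H (pedges p))"

definition saturated_end_wins :: "nat \<Rightarrow> nat \<Rightarrow> bool" where
  "saturated_end_wins m V \<longleftrightarrow> (\<forall>H p js c n. board H p js c \<and> saturated H (hd p) \<and> length p = V \<and>
     length js \<le> 2 \<and> 6 * m + 7 \<le> 2 * n + 3 * V + length js + c
     \<longrightarrow> win (2 * m + 1) n H (pedges p))"

section \<open>Growing a path with a saturated root\<close>

lemma free_end_winsD:
  assumes "free_end_wins m V" "board H p js c" "hd p \<notin> \<Union>H" "length p = V"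
    "length js \<le> 1 \<or> length js = 2 \<and> V + 2 \<le> 2 * m" "6 * m + 9 \<le> 2 * n + 3 * V + length js + c"
  shows "win (2 * m + 1) n H (pedges p)"
  using assms unfolding free_end_wins_def by blast

lemma saturated_end_winsD:
  assumes "saturated_end_wins m V" "board H p js c" "saturated H (hd p)" "length p = V"
    "length js \<le> 2" "6 * m + 7 \<le> 2 * n + 3 * V + length js + c"
  shows "win (2 * m + 1) n H (pedges p)"
  using assms unfolding saturated_end_wins_def by blast

lemma board_rooted: "board H p js c \<Longrightarrow> rooted H p"
  unfolding board_def rooted_def by simp

text \<open>If an edge from \<open>g\<close> to a fresh vertex goes to \<open>H\<close>, it buys two
  green edges: head and \<open>g\<close> are both saturated and get linked through a free vertex,
  while the far end of the new edge replaces \<open>g\<close> in reserve. If two such edges are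
  green, three vertices are gained without any edge of \<open>H\<close>, which covers both the loss
  of \<open>g\<close> and the change to a free head.\<close>

lemma saturated_end_half_step:
  assumes Y: "saturated_end_wins m (V + 2)" and X: "free_end_wins m (V + 3)"
    and b: "board H p (g # js) c" and s: "saturated H (hd p)" and V: "length p = V" "V + 2 \<le> 2 * m"
    and js: "length js \<le> 1" and n: "6 * m + 7 \<le> 2 * n + 3 * V + length js + 1 + c"
  shows "win (2 * m + 1) n H (pedges p)"
proof -
  have fin: "finite (\<Union>H)" and p: "p \<noteq> []" "distinct p" "hd p \<in> set p" "last p \<in> set p"
    and sr: "saturated H (last p)" and g: "half H g" "g \<notin> set p" "g \<notin> set js"
    and js': "distinct js" "set p \<inter> set js = {}" "\<forall>j\<in>set js. half H j" and c: "c \<le> 1"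
    using b by (auto simp: board_def)
  obtain x where x: "x \<notin> \<Union>H" "x \<notin> set p" "x \<noteq> g" "x \<notin> set js"
    using fresh_vertex[of H "insert g (set p \<union> set js)"] fin by auto
  let ?H = "insert {g, x} H"
  \<comment> \<open>Three rounds are played below; this keeps the truncated subtractions
    exact.\<close>
  have n4: "4 \<le> n" using n V js c by linarith
  show ?thesis
  proof (rule win_moveI[of n g x])
    have sg: "saturated ?H g"
      by (rule saturated_insert_half[OF g(1)]) (rule not_in_edges[OF x(1)])
    have hx: "half ?H x" by (rule half_insert_new(2)[OF x(1,3)])
    have hj: "\<forall>j\<in>set js. half ?H j"
      using js' x g by (auto intro!: half_insert_other)
    show "win (2 * m + 1) (n - 1) ?H (pedges p)"
    proof (rule win_extend_forced[of ?H "insert g (set js)"])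
      fix z assume z: "z \<notin> \<Union>?H" "z \<notin> set p" "z \<notin> insert g (set js)"
      show "win (2 * m + 1) (n - 1 - 1) ?H (pedges (z # p))"
      proof (rule win_forcedI[of _ _ g z])
        show "{g, z} \<notin> ?H" using z by blast
        show "{g, z} \<notin> pedges (z # p)" using g(2) z(3) by (intro not_in_pedges) auto
        have "board ?H (g # z # p) (x # js) c"
          using b x z hx hj by (auto simp: board_def saturated_insert doubleton_eq_iff)
        then have "win (2 * m + 1) (n - 1 - 1 - 1) ?H (pedges (g # z # p))"
          using sg V n js n4 by (intro saturated_end_winsD[OF Y]) auto
        then show "win (2 * m + 1) (n - 1 - 1 - 1) ?H (insert {g, z} (pedges (z # p)))" by simp
      qed (use sg n4 z in auto)
    qed (use n4 p fin s in \<open>auto simp: saturated_insert\<close>)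
    obtain y where y: "y \<notin> \<Union>H" "y \<notin> set p" "y \<noteq> g" "y \<notin> set js" "y \<noteq> x"
      using fresh_vertex[of H "insert x (insert g (set p \<union> set js))"] fin by auto
    \<comment> \<open>The edge from the saturated head to \<open>x\<close> is forced whenever it is
      drawn, so it is postponed until \<open>g\<close> has been tested a second time.\<close>
    let ?K = "insert {g, y} H" and ?G = "insert {g, x} (pedges p)"
    show "win (2 * m + 1) (n - 1) H ?G"
    proof (rule win_moveI[of _ g y])
      have sg: "saturated ?K g"
        by (rule saturated_insert_half[OF g(1)]) (rule not_in_edges[OF y(1)])
      have hx: "half ?K y" by (rule half_insert_new(2)[OF y(1,3)])
      have hj: "\<forall>j\<in>set js. half ?K j"
        using js' y g by (auto intro!: half_insert_other)
      have e: "insert {hd p, x} ?G = pedges (g # x # p)"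
        using p by (auto simp: pedges_Cons insert_commute)
      show "win (2 * m + 1) (n - 1 - 1) ?K ?G"
      proof (rule win_forcedI[of _ _ "hd p" x])
        have "board ?K (g # x # p) (y # js) c"
          using b x y hx hj by (auto simp: board_def saturated_insert doubleton_eq_iff)
        then show "win (2 * m + 1) (n - 1 - 1 - 1) ?K (insert {hd p, x} ?G)"
          unfolding e using sg V n js n4 by (intro saturated_end_winsD[OF Y]) auto
        show "{hd p, x} \<notin> ?K" "{hd p, x} \<notin> ?G" "hd p \<noteq> x"
          using p x y g(2) not_in_pedges(2)[OF x(2)] by (auto simp: doubleton_eq_iff)
      qed (use n4 s in \<open>auto simp: saturated_insert\<close>)
      have e': "insert {hd p, x} (insert {g, y} ?G) = pedges (y # g # x # p)"
        using p by (auto simp: pedges_Cons insert_commute)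
      show "win (2 * m + 1) (n - 1 - 1) H (insert {g, y} ?G)"
      proof (rule win_forcedI[of _ _ "hd p" x])
        have "board H (y # g # x # p) js c"
          using b x y by (auto simp: board_def)
        then show "win (2 * m + 1) (n - 1 - 1 - 1) H (insert {hd p, x} (insert {g, y} ?G))"
          unfolding e' using V n js n4 y(1) by (intro free_end_winsD[OF X]) auto
        show "{hd p, x} \<notin> H" "{hd p, x} \<notin> insert {g, y} ?G" "hd p \<noteq> x"
          using p x y g(2) not_in_pedges(2)[OF x(2)] by (auto simp: doubleton_eq_iff)
      qed (use n4 s in auto)
    qed (use n4 y x not_in_pedges(2)[OF y(2)] in \<open>auto simp: doubleton_eq_iff\<close>)
  qed (use n4 x not_in_pedges(2)[OF x(2)] in auto)
qed

text \<open>With an empty reserve, an edge between two fresh vertices either fills the reserve with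
  both of them or prolongs the path by two after one forced edge. \<open>Y\<close> has the same
  length \<open>V\<close> but a nonempty reserve, so the recursion is well-founded.\<close>

lemma saturated_end_step:
  assumes Y: "\<And>H p g js c n. \<lbrakk>board H p (g # js) c; saturated H (hd p); length p = V; length js \<le> 1;
      6 * m + 7 \<le> 2 * n + 3 * V + length js + 1 + c\<rbrakk> \<Longrightarrow> win (2 * m + 1) n H (pedges p)"
    and X: "free_end_wins m (V + 2)"
    and b: "board H p [] c" and s: "saturated H (hd p)" and V: "length p = V" "V + 1 \<le> 2 * m"
    and n: "6 * m + 7 \<le> 2 * n + 3 * V + c"
  shows "win (2 * m + 1) n H (pedges p)"
proof -
  have fin: "finite (\<Union>H)" and p: "p \<noteq> []" "distinct p" "hd p \<in> set p" "last p \<in> set p"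
    and sr: "saturated H (last p)" and c: "c \<le> 1"
    using b by (auto simp: board_def)
  obtain u where u: "u \<notin> \<Union>H" "u \<notin> set p" using fresh_vertex[of H "set p"] fin by auto
  obtain v where v: "v \<notin> \<Union>H" "v \<notin> set p" "v \<noteq> u" using fresh_vertex[of H "insert u (set p)"] fin by auto
  let ?H = "insert {u, v} H" and ?G = "insert {u, v} (pedges p)"
  have n4: "4 \<le> n" using n V c by linarith
  show ?thesis
  proof (rule win_moveI[of n u v])
    have "half ?H u" "half ?H v"
      using half_insert_new[of u H v] half_insert_new[of v H u] u v by auto
    then have "board ?H p [u, v] c"
      using b u v by (auto simp: board_def saturated_insert doubleton_eq_iff)
    then show "win (2 * m + 1) (n - 1) ?H (pedges p)"
      using s V n n4 by (intro Y) (auto simp: saturated_insert)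
    have e: "insert {hd p, u} ?G = pedges (v # u # p)"
      using p by (auto simp: pedges_Cons insert_commute)
    show "win (2 * m + 1) (n - 1) H ?G"
    proof (rule win_forcedI[of _ _ "hd p" u])
      have "board H (v # u # p) [] c" using b u v by (auto simp: board_def)
      then show "win (2 * m + 1) (n - 1 - 1) H (insert {hd p, u} ?G)"
        unfolding e using V n n4 v(1) by (intro free_end_winsD[OF X]) auto
      show "{hd p, u} \<notin> H" "{hd p, u} \<notin> ?G" "hd p \<noteq> u"
        using p u v not_in_pedges(2)[OF u(2)] by (auto simp: doubleton_eq_iff)
    qed (use n4 s in auto)
  qed (use n4 u v not_in_pedges(2)[OF v(2)] in auto)
qed

text \<open>The edge from the head to \<open>j\<close> is useful either way. In \<open>H\<close> it
  saturates \<open>j\<close>, and one more refusal saturates the head as well. Green, it makes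
  \<open>j\<close> the head, and a single refusal then saturates it.\<close>

lemma free_end_half_step:
  assumes Y1: "saturated_end_wins m (V + 1)" and Y2: "saturated_end_wins m (V + 2)"
    and X: "free_end_wins m (V + 2)"
    and b: "board H p (j # js) c" and s: "hd p \<notin> \<Union>H" and V: "length p = V" "V + 2 \<le> 2 * m"
    and js: "length js \<le> 1" and n: "6 * m + 9 \<le> 2 * n + 3 * V + length js + 1 + c"
  shows "win (2 * m + 1) n H (pedges p)"
proof -
  have fin: "finite (\<Union>H)" and p: "p \<noteq> []" "distinct p" "hd p \<in> set p" "last p \<in> set p"
    and sr: "saturated H (last p)" and j: "half H j" "j \<notin> set p" "j \<notin> set js"
    and js': "distinct js" "set p \<inter> set js = {}" "\<forall>j\<in>set js. half H j" and c: "c \<le> 1"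
    using b by (auto simp: board_def)
  have hl: "hd p \<noteq> last p" using s saturated_in[OF sr] by auto
  have hj: "hd p \<noteq> j" using p j by auto
  have nH: "{hd p, j} \<notin> H" using s by blast
  have hdjs: "hd p \<notin> set js" using p(3) js'(2) by blast
  have n5: "5 \<le> n" using n V js c by linarith
  show ?thesis
  proof (rule win_moveI[of n "hd p" j])
    let ?H = "insert {hd p, j} H"
    have sj: "saturated ?H j"
      using saturated_insert_half(2)[OF j(1), of "hd p"] nH by (simp add: insert_commute)
    have hp: "half ?H (hd p)" using half_insert_new(1)[OF s hj] .
    have hjs: "\<forall>i\<in>set js. half ?H i"
      using js' hdjs j by (auto intro!: half_insert_other)
    show "win (2 * m + 1) (n - 1) ?H (pedges p)"
    proof (rule win_extend[of ?H "insert j (set js)"])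
      fix g assume g: "g \<notin> \<Union>?H" "g \<notin> set p" "g \<notin> insert j (set js)"
      show "win (2 * m + 1) (n - 1 - 1) ?H (pedges (g # p))"
      proof (rule win_forcedI[of _ _ j g])
        show "{j, g} \<notin> ?H" using g by blast
        show "{j, g} \<notin> pedges (g # p)" using j(2) g(3) by (intro not_in_pedges) auto
        have "board ?H (j # g # p) js c"
          using b g hjs hl hj by (auto simp: board_def saturated_insert doubleton_eq_iff)
        then have "win (2 * m + 1) (n - 1 - 1 - 1) ?H (pedges (j # g # p))"
          using sj V n n5 js by (intro saturated_end_winsD[OF Y2]) auto
        then show "win (2 * m + 1) (n - 1 - 1 - 1) ?H (insert {j, g} (pedges (g # p)))" by simp
      qed (use sj n5 g in auto)
      let ?K = "insert {hd p, g} ?H"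
      have sh: "saturated ?K (hd p)" using hp g by (intro saturated_insert_half) auto
      have hg: "half ?K g" using g p by (intro half_insert_new(2)) auto
      have hk: "\<forall>i\<in>set js. half ?K i"
        using js' hdjs j g by (auto intro!: half_insert_other)
      show "win (2 * m + 1) (n - 1 - 1) ?K (pedges p)"
      proof (rule win_extend_forced[of ?K "insert g (insert j (set js))"])
        fix z assume z: "z \<notin> \<Union>?K" "z \<notin> set p" "z \<notin> insert g (insert j (set js))"
        show "win (2 * m + 1) (n - 1 - 1 - 1) ?K (pedges (z # p))"
        proof (rule win_forcedI[of _ _ j z])
          show "{j, z} \<notin> ?K" using z by blast
          show "{j, z} \<notin> pedges (z # p)" using j(2) z(3) by (intro not_in_pedges) auto
          \<comment> \<open>No slack here: the two new edges of \<open>H\<close> are paid for by two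
            new path vertices and by the head becoming saturated.\<close>
          have "board ?K (j # z # p) (g # js) c"
            using b g z hg hk hl hj by (auto simp: board_def saturated_insert doubleton_eq_iff)
          then have "win (2 * m + 1) (n - 1 - 1 - 1 - 1) ?K (pedges (j # z # p))"
            using sj V n n5 js by (intro saturated_end_winsD[OF Y2]) (auto simp: saturated_insert)
          then show "win (2 * m + 1) (n - 1 - 1 - 1 - 1) ?K (insert {j, z} (pedges (z # p)))" by simp
        qed (use sj n5 z in \<open>auto simp: saturated_insert\<close>)
      qed (use n5 p fin sh in auto)
    qed (use n5 p fin in auto)
    have e: "insert {hd p, j} (pedges p) = pedges (j # p)"
      using p by (simp add: pedges_Cons insert_commute)
    show "win (2 * m + 1) (n - 1) H (insert {hd p, j} (pedges p))"
      unfolding e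
    proof (rule win_extend[of H "set js"])
      fix w assume w: "w \<notin> \<Union>H" "w \<notin> set (j # p)" "w \<notin> set js"
      have "board H (w # j # p) js c" using b w by (auto simp: board_def)
      then show "win (2 * m + 1) (n - 1 - 1) H (pedges (w # j # p))"
        using w V n n5 js by (intro free_end_winsD[OF X]) auto
      have "saturated (insert {j, w} H) j"
        by (rule saturated_insert_half[OF j(1)]) (rule not_in_edges[OF w(1)])
      moreover have "half (insert {j, w} H) w" using w by (intro half_insert_new(2)) auto
      moreover have "\<forall>i\<in>set js. half (insert {j, w} H) i"
        using js' j w by (auto intro!: half_insert_other)
      ultimately show "win (2 * m + 1) (n - 1 - 1) (insert {hd (j # p), w} H) (pedges (j # p))"
        using V n n5 js b w p j
        by (intro saturated_end_winsD[OF Y1, of _ _ "w # js" c])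
          (auto simp: board_def saturated_insert doubleton_eq_iff)
    qed (use n5 p j fin in auto)
  qed (use hj nH n5 not_in_pedges(2)[OF j(2)] in auto)
qed

text \<open>The head is tested at most twice. If only the first test is refused, the half-saturation
  of the head is buried in the path but \<open>z\<close> stays in reserve; two refusals leave a
  saturated head with two vertices in reserve.\<close>

lemma free_end_step:
  assumes Y: "saturated_end_wins m V" and X: "free_end_wins m (V + 1)"
    and b: "board H p [] c" and s: "hd p \<notin> \<Union>H" and V: "length p = V" "V \<le> 2 * m"
    and n: "6 * m + 9 \<le> 2 * n + 3 * V + c"
  shows "win (2 * m + 1) n H (pedges p)"
proof -
  have fin: "finite (\<Union>H)" and p: "p \<noteq> []" "distinct p" "hd p \<in> set p" "last p \<in> set p"
    and sr: "saturated H (last p)" and c: "c \<le> 1"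
    using b by (auto simp: board_def)
  have hl: "hd p \<noteq> last p" using s saturated_in[OF sr] by auto
  have n4: "4 \<le> n" using n V c by linarith
  show ?thesis
  proof (rule win_extend[of H "{}"])
    fix z assume z: "z \<notin> \<Union>H" "z \<notin> set p"
    have "board H (z # p) [] c" using b z by (auto simp: board_def)
    then show "win (2 * m + 1) (n - 1) H (pedges (z # p))"
      using z V n n4 by (intro free_end_winsD[OF X]) auto
    let ?H = "insert {hd p, z} H"
    have zp: "hd p \<noteq> z" using z p by auto
    have hz: "half ?H z" using z zp by (intro half_insert_new(2)) auto
    show "win (2 * m + 1) (n - 1) ?H (pedges p)"
    proof (rule win_extend[of ?H "{}"])
      fix w assume w: "w \<notin> \<Union>?H" "w \<notin> set p"
      have "board ?H (w # p) [z] c"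
        using b z w hz hl zp by (auto simp: board_def saturated_insert doubleton_eq_iff)
      then show "win (2 * m + 1) (n - 1 - 1) ?H (pedges (w # p))"
        using w V n n4 by (intro free_end_winsD[OF X]) auto
      let ?K = "insert {hd p, w} ?H"
      have "half ?H (hd p)" using half_insert_new(1)[OF s zp] .
      then have "saturated ?K (hd p)"
        by (rule saturated_insert_half) (rule not_in_edges[OF w(1)])
      moreover have "half ?K z" by (rule half_insert_other[OF hz]) (use z w zp in auto)
      moreover have "half ?K w" using w p by (intro half_insert_new(2)) auto
      ultimately show "win (2 * m + 1) (n - 1 - 1) ?K (pedges p)"
        using b z w hl V n n4
        by (intro saturated_end_winsD[OF Y, of _ _ "[z, w]" c])
          (auto simp: board_def saturated_insert doubleton_eq_iff)
    qed (use n4 p fin in auto)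
  qed (use n4 p fin in auto)
qed

lemma free_end_wins_top: "1 \<le> m \<Longrightarrow> free_end_wins m (2 * m + 1)"
  unfolding free_end_wins_def
  by (auto simp: rooted_def board_def intro!: win_free_end_missing_0)

lemma saturated_end_wins_top: "1 \<le> m \<Longrightarrow> saturated_end_wins m (2 * m)"
  unfolding saturated_end_wins_def
  by (auto simp: rooted_def board_def intro!: win_saturated_end_missing_1)

text \<open>Downward induction on \<open>V\<close>. At each length saturated heads with a nonempty
  reserve come first, then all saturated heads, then free heads, since the later cases fall back on
  the earlier ones at the same length.\<close>

lemma ends_win_below:
  assumes "2 \<le> m" "V \<le> 2 * m"
  shows "saturated_end_wins m V" "free_end_wins m V"
proof -
  have "saturated_end_wins m V \<and> free_end_wins m V"
    using assms(2)
  proof (induction "2 * m - V" arbitrary: V rule: less_induct)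
    case less
    have IHX: "free_end_wins m W" if "V < W" "W \<le> 2 * m + 1" for W
      using less.hyps[of W] that free_end_wins_top[of m] assms(1)
      by (cases "W = 2 * m + 1") auto
    have IHY: "saturated_end_wins m W" if "V < W" "W \<le> 2 * m" for W
      using less.hyps[of W] that by auto
    have Yhalf: "win (2 * m + 1) n H (pedges p)"
      if a: "board H p (g # js) c" "saturated H (hd p)" "length p = V" "length js \<le> 1"
        "6 * m + 7 \<le> 2 * n + 3 * V + length js + 1 + c" for H p g js c n
    proof -
      have c: "c \<le> 1" using a(1) by (auto simp: board_def)
      consider "V = 2 * m" | "V + 1 = 2 * m" | "V + 2 \<le> 2 * m" using less.prems by linarith
      then show ?thesis
      proof cases
        case 1
        then show ?thesis
          using a c assms(1) by (intro win_saturated_end_missing_1) (auto simp: board_rooted)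
      next
        case 2
        then show ?thesis
          using a c assms(1) board_rooted[OF a(1)]
          by (intro win_saturated_end_missing_2[of _ _ _ _ g]) (auto simp: board_def)
      next
        case 3
        then show ?thesis
          using a by (intro saturated_end_half_step[OF IHY IHX]) auto
      qed
    qed
    have Y: "saturated_end_wins m V"
      unfolding saturated_end_wins_def
    proof (intro allI impI, elim conjE)
      fix H p js c n
      assume a: "board H p js c" "saturated H (hd p)" "length p = V" "length js \<le> 2"
        "6 * m + 7 \<le> 2 * n + 3 * V + length js + c"
      show "win (2 * m + 1) n H (pedges p)"
      proof (cases js)
        case (Cons g js')
        then show ?thesis using a by (intro Yhalf[of H p g js' c]) auto
      next
        case Nil
        show ?thesis
        proof (cases "V = 2 * m")
          case True
          then show ?thesis
            using saturated_end_wins_top[of m] assms(1) a saturated_end_winsD by auto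
        next
          case False
          then show ?thesis
            using a Nil less.prems IHX[of "V + 2"] by (intro saturated_end_step[OF Yhalf]) auto
        qed
      qed
    qed
    have X: "free_end_wins m V"
      unfolding free_end_wins_def
    proof (intro allI impI, elim conjE)
      fix H p js c n
      assume a: "board H p js c" "hd p \<notin> \<Union>H" "length p = V"
        "length js \<le> 1 \<or> length js = 2 \<and> V + 2 \<le> 2 * m"
        "6 * m + 9 \<le> 2 * n + 3 * V + length js + c"
      have r: "rooted H p" using a(1) by (rule board_rooted)
      have c: "c \<le> 1" using a(1) by (auto simp: board_def)
      show "win (2 * m + 1) n H (pedges p)"
      proof (cases js)
        case Nil
        then show ?thesis
          using a less.prems by (intro free_end_step[OF Y IHX]) auto
      next
        case (Cons j js')
        \<comment> \<open>At these last lengths the reserve is a single vertex. For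
          \<open>V + 1 = 2 * m\<close> the threshold grants six rounds if \<open>c = 0\<close> but
          only five if \<open>c = 1\<close>; there the nonadjacency demanded by \<open>board\<close>
          makes up for the missing round.\<close>
        consider "V = 2 * m" | "V + 1 = 2 * m" "c = 0" | "V + 1 = 2 * m" "c = 1" | "V + 2 \<le> 2 * m"
          using less.prems c by linarith
        then show ?thesis
        proof cases
          case 1
          then show ?thesis
            using a c assms(1) r Cons by (intro win_free_end_missing_1) auto
        next
          case 2
          then show ?thesis
            using a assms(1) r Cons by (intro win_free_end_missing_2) auto
        next
          case 3
          then show ?thesis
            using a assms(1) r Cons
            by (intro win_free_end_missing_2_nonadjacent[of _ _ _ _ j])
              (auto simp: board_def insert_commute)
        next
          case 4
          then show ?thesis
            using a Cons by (intro free_end_half_step[OF IHY IHY IHX, where j = j and js = js' and c = c]) auto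
        qed
      qed
    qed
    from X Y show ?case by simp
  qed
  then show "saturated_end_wins m V" "free_end_wins m V" by auto
qed

section \<open>Paths with two ends untouched by \<open>H\<close>\<close>

text \<open>The chords replace the edge between \<open>p\<close> and \<open>q\<close>; the cycle is
  \<open>p @ rev q\<close>.\<close>

lemma win_crossing_chords:
  assumes "distinct (p @ q)" "length (p @ q) = l" "3 \<le> l" "p \<noteq> []" "q \<noteq> []" "pedges (p @ q) \<subseteq> G"
    "{hd p, hd q} \<in> G" "{last p, last q} \<in> G"
  shows "win l n H G"
proof (rule win_cycle[of "p @ rev q"])
  show "pedges (p @ rev q) \<subseteq> G"
    using assms by (simp add: pedges_append pedges_rev hd_rev)
qed (use assms in \<open>auto simp: last_rev\<close>)

text \<open>Once the closing edge is refused, \<open>{a, y}\<close> is tried. Green, it closes a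
  cycle through all vertices but \<open>z\<close>, which is then inserted between two neighbors.
  Refused, it saturates \<open>a\<close>, so that one of two crossing chords is always
  forced.\<close>

lemma win_free_path_missing_0:
  assumes H: "finite (\<Union>H)" "distinct p" "length p = l" "8 \<le> l" "hd p \<notin> \<Union>H" "last p \<notin> \<Union>H" and n: "5 \<le> n"
  shows "win l n H (pedges p)"
proof -
  obtain z y x u v w q where p: "p = z # y # x # u # v # w # q"
    using assms(3,4) by (auto simp: Suc_le_length_iff numeral_eq_Suc)
  define a where "a = last (w # q)"
  have a: "last p = a" "a \<in> set (w # q)" unfolding a_def p by (auto simp: last_in_set)
  have d: "distinct [z, y, x, u, v, a]" "set [z, y, x, u, v] \<inter> set (w # q) = {}" "distinct (w # q)"
    using H(2) a unfolding p by auto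
  have F: "{z, b} \<notin> H" "{b, z} \<notin> H" "{a, b} \<notin> H" "{b, a} \<notin> H" for b
    using H(5,6) a unfolding p by (auto simp: not_in_edges)
  let ?P = "pedges (w # q)"
  have pe: "pedges p = insert {z, y} (insert {y, x} (insert {x, u} (insert {u, v} (insert {v, w} ?P))))"
    unfolding p by simp
  have nP: "{b, c} \<notin> ?P" "{c, b} \<notin> ?P" if "b \<in> {z, y, x, u, v}" for b c
  proof -
    have "b \<notin> set (w # q)" using d(2) that by auto
    then show "{b, c} \<notin> ?P" "{c, b} \<notin> ?P" by (rule not_in_pedges)+
  qed
  have aq: "q \<noteq> []" "last q = a" using assms(3,4) unfolding p a_def by auto
  have aw: "a \<noteq> w" using assms(3,4) d unfolding p a_def by (cases q) (auto split: if_splits)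
  have ne: "{a, z} \<notin> pedges p" "{a, y} \<notin> pedges p" "{z, x} \<notin> pedges p" "{z, u} \<notin> pedges p"
    "{z, v} \<notin> pedges p" "{a, x} \<notin> pedges p" "{a, u} \<notin> pedges p"
    unfolding pe using nP d aw by (auto simp: doubleton_eq_iff)
  let ?G = "pedges p"
  have "win l n H ?G"
  proof (rule win_moveI[of n a z])
    show "win l (n - 1) H (insert {a, z} ?G)"
      using a assms(3,4) H(2) p by (intro win_cycle[of p]) (auto simp del: pedges.simps)
    let ?H = "insert {a, z} H"
    show "win l (n - 1) ?H ?G"
    proof (rule win_moveI[of _ a y])
      let ?G1 = "insert {a, y} ?G"
      show "win l (n - 1 - 1) ?H ?G1"
      proof (rule win_moveI[of _ z x])
        show "win l (n - 1 - 1 - 1) ?H (insert {z, x} ?G1)"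
          using assms(4)
          by (intro win_cycle[of "y # z # x # u # v # w # q"])
            ((use H(2,3) d aq in \<open>auto simp: p\<close>)[2], simp, simp add: p insert_commute, blast,
             simp add: aq insert_commute)
        let ?K = "insert {z, x} ?H"
        have sz: "saturated ?K z"
          unfolding saturated_def using d by (intro exI[of _ a] exI[of _ x]) auto
        show "win l (n - 1 - 1 - 1) ?K ?G1"
        proof (rule win_forcedI[OF _ sz, of _ u])
          show "win l (n - 1 - 1 - 1 - 1) ?K (insert {z, u} ?G1)"
          proof (rule win_forcedI[OF _ sz, of _ v])
            \<comment> \<open>The two forced edges insert \<open>z\<close> between \<open>u\<close>
              and \<open>v\<close>.\<close>
            show "win l (n - 1 - 1 - 1 - 1 - 1) ?K (insert {z, v} (insert {z, u} ?G1))"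
              using assms(4)
              by (intro win_cycle[of "y # x # u # z # v # w # q"])
                ((use H(2,3) d aq in \<open>auto simp: p\<close>)[2], simp, simp add: p insert_commute, blast,
                 simp add: aq insert_commute)
          qed (use n d F ne in \<open>auto simp: doubleton_eq_iff\<close>)
        qed (use n d F ne in \<open>auto simp: doubleton_eq_iff\<close>)
      qed (use n d F ne in \<open>auto simp: doubleton_eq_iff\<close>)
      let ?K = "insert {a, y} ?H"
      have sa: "saturated ?K a"
        unfolding saturated_def using d by (intro exI[of _ y] exI[of _ z]) auto
      \<comment> \<open>The chords first enclose \<open>{x, u}\<close>. If \<open>{z, u}\<close> is
        refused, \<open>z\<close> is saturated too, and both chords around \<open>{u, v}\<close> are
        forced.\<close>
      show "win l (n - 1 - 1) ?K ?G"
      proof (rule win_moveI[of _ z u])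
        show "win l (n - 1 - 1 - 1) ?K (insert {z, u} ?G)"
        proof (rule win_forcedI[OF _ sa, of _ x])
          show "win l (n - 1 - 1 - 1 - 1) ?K (insert {a, x} (insert {z, u} ?G))"
            using H(2,3) assms(4) aq p by (intro win_crossing_chords[of "[z, y, x]" "u # v # w # q"]) auto
        qed (use n d F ne in \<open>auto simp: doubleton_eq_iff\<close>)
        let ?L = "insert {z, u} ?K"
        have sz: "saturated ?L z"
          unfolding saturated_def using d by (intro exI[of _ a] exI[of _ u]) auto
        show "win l (n - 1 - 1 - 1) ?L ?G"
        proof (rule win_forcedI[OF _ sz, of _ v])
          show "win l (n - 1 - 1 - 1 - 1) ?L (insert {z, v} ?G)"
          proof (rule win_forcedI[of _ _ a u])
            show "saturated ?L a" using sa by (rule saturated_insert)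
            show "win l (n - 1 - 1 - 1 - 1 - 1) ?L (insert {a, u} (insert {z, v} ?G))"
              using H(2,3) assms(4) aq p by (intro win_crossing_chords[of "[z, y, x, u]" "v # w # q"]) auto
          qed (use n d F ne in \<open>auto simp: doubleton_eq_iff\<close>)
        qed (use n d F ne in \<open>auto simp: doubleton_eq_iff\<close>)
      qed (use n d F ne in \<open>auto simp: doubleton_eq_iff\<close>)
    qed (use n d F ne in \<open>auto simp: doubleton_eq_iff\<close>)
  qed (use n d F ne in \<open>auto simp: doubleton_eq_iff\<close>)
  then show ?thesis .
qed

text \<open>Testing the head costs at most two rounds: a green answer prolongs a path with free
  ends, two refusals turn the head into a root after reversal.\<close>

lemma win_free_path_missing_1:
  assumes "finite (\<Union>H)" "distinct p" "length p + 1 = l" "8 \<le> l" "hd p \<notin> \<Union>H" "last p \<notin> \<Union>H" "7 \<le> n"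
  shows "win l n H (pedges p)"
proof -
  have "p \<noteq> []" using assms(3,4) by auto
  then have p: "p \<noteq> []" "hd p \<in> set p" "last p \<in> set p" by auto
  have hl: "hd p \<noteq> last p" using assms(2-4) by (cases p) (auto split: if_splits)
  show ?thesis
  proof (rule win_extend[of H "{}"])
    fix z assume z: "z \<notin> \<Union>H" "z \<notin> set p"
    then show "win l (n - 1) H (pedges (z # p))"
      using assms p by (intro win_free_path_missing_0) auto
    let ?H = "insert {hd p, z} H"
    have zp: "hd p \<noteq> z" "z \<noteq> last p" using z p by auto
    show "win l (n - 1) ?H (pedges p)"
    proof (rule win_extend[of ?H "{}"])
      fix w assume w: "w \<notin> \<Union>?H" "w \<notin> set p"
      then show "win l (n - 1 - 1) ?H (pedges (w # p))"
        using assms p zp hl by (intro win_free_path_missing_0) auto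
      let ?K = "insert {hd p, w} ?H"
      have "saturated ?K (hd p)"
        unfolding saturated_def using w by (intro exI[of _ w] exI[of _ z]) auto
      then have "win l (n - 1 - 1) ?K (pedges (rev p))"
        using assms p w zp hl
        by (intro win_free_end_missing_1) (auto simp: rooted_def last_rev hd_rev)
      then show "win l (n - 1 - 1) ?K (pedges p)" by (simp add: pedges_rev)
    qed (use assms p in auto)
  qed (use assms p in auto)
qed

lemma win_free_path_missing_2:
  assumes "finite (\<Union>H)" "distinct p" "length p + 2 = l" "8 \<le> l" "hd p \<notin> \<Union>H" "last p \<notin> \<Union>H" "9 \<le> n"
  shows "win l n H (pedges p)"
proof -
  have "p \<noteq> []" using assms(3,4) by auto
  then have p: "p \<noteq> []" "hd p \<in> set p" "last p \<in> set p" by auto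
  have hl: "hd p \<noteq> last p" using assms(2-4) by (cases p) (auto split: if_splits)
  show ?thesis
  proof (rule win_extend[of H "{}"])
    fix z assume z: "z \<notin> \<Union>H" "z \<notin> set p"
    then show "win l (n - 1) H (pedges (z # p))"
      using assms p by (intro win_free_path_missing_1) auto
    let ?H = "insert {hd p, z} H"
    have zp: "hd p \<noteq> z" "z \<noteq> last p" using z p by auto
    show "win l (n - 1) ?H (pedges p)"
    proof (rule win_extend[of ?H "{}"])
      fix w assume w: "w \<notin> \<Union>?H" "w \<notin> set p"
      then show "win l (n - 1 - 1) ?H (pedges (w # p))"
        using assms p zp hl by (intro win_free_path_missing_1) auto
      let ?K = "insert {hd p, w} ?H"
      have "saturated ?K (hd p)"
        unfolding saturated_def using w by (intro exI[of _ w] exI[of _ z]) auto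
      then have "win l (n - 1 - 1) ?K (pedges (rev p))"
        using assms p w zp hl
        by (intro win_free_end_missing_2) (auto simp: rooted_def last_rev hd_rev)
      then show "win l (n - 1 - 1) ?K (pedges p)" by (simp add: pedges_rev)
    qed (use assms p in auto)
  qed (use assms p in auto)
qed

text \<open>The one position that incurs the debt: the path is too short to pay for its saturated root,
  unless the role of the root is passed on to \<open>e\<close>.\<close>

lemma win_short_path:
  assumes m: "8 \<le> m" and H: "finite (\<Union>H)" "distinct [h, u, e, f]" "h \<notin> \<Union>H" "{u, e} \<in> H" "{u, f} \<in> H"
    "half H e" "half H f" and n: "3 * m \<le> n"
  shows "win (2 * m + 1) n H (pedges [h, u])"
proof -
  note YD = saturated_end_winsD[OF ends_win_below(1)] and XD = free_end_winsD[OF ends_win_below(2)]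
  have su: "saturated H u" unfolding saturated_def using H by (intro exI[of _ e] exI[of _ f]) auto
  have hne: "{h, b} \<notin> H" for b using H(3) by blast
  have ef: "{e, f} \<notin> H" using H(2,4,6) unfolding half_def by (metis distinct_length_2_or_more insert_commute)
  show ?thesis
  proof (rule win_moveI[of n h e])
    let ?H = "insert {h, e} H"
    have se: "saturated ?H e"
      using saturated_insert_half(2)[OF H(6), of h] hne[of e] by (simp add: insert_commute)
    have hh: "half ?H h" using H by (intro half_insert_new(1)) auto
    have hf: "half ?H f" using H by (intro half_insert_other) auto
    show "win (2 * m + 1) (n - 1) ?H (pedges [h, u])"
    proof (rule win_extend[of ?H "{e, f}"])
      fix g assume g: "g \<notin> \<Union>?H" "g \<notin> set [h, u]" "g \<notin> {e, f}"
      show "win (2 * m + 1) (n - 1 - 1) ?H (pedges [g, h, u])"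
      proof (rule win_forcedI[OF _ se, of _ g])
        have "win (2 * m + 1) (n - 1 - 1 - 1) ?H (pedges [e, g, h, u])"
          using H g se su hf m n
          by (intro YD[of _ 4 _ _ "[f]" 0]) (auto simp: board_def saturated_insert)
        then show "win (2 * m + 1) (n - 1 - 1 - 1) ?H (insert {e, g} (pedges [g, h, u]))" by simp
        show "{e, g} \<notin> ?H" using g by blast
        show "{e, g} \<notin> pedges [g, h, u]" using H g by (intro not_in_pedges) auto
      qed (use m n g in auto)
      let ?K = "insert {h, g} ?H"
      have sh: "saturated ?K h" using hh g by (intro saturated_insert_half) auto
      have hg: "half ?K g" using g H by (intro half_insert_new(2)) auto
      have hf': "half ?K f" using hf H g by (intro half_insert_other) auto
      have seK: "saturated ?K e" using se by (rule saturated_insert)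
      have "win (2 * m + 1) (n - 1 - 1) ?K (pedges [h, u])"
      proof (rule win_extend_forced[of ?K "{e, f, g}"])
        fix z assume z: "z \<notin> \<Union>?K" "z \<notin> set [h, u]" "z \<notin> {e, f, g}"
        show "win (2 * m + 1) (n - 1 - 1 - 1) ?K (pedges [z, h, u])"
        proof (rule win_forcedI[OF _ seK, of _ z])
          \<comment> \<open>Reversal makes \<open>e\<close> the root. Its neighbors in
            \<open>H\<close> are now \<open>u\<close> and \<open>h\<close>, so neither
            \<open>f\<close> nor \<open>g\<close> is joined to it and the debt \<open>c = 1\<close>
            is admissible.\<close>
          have "win (2 * m + 1) (n - 1 - 1 - 1 - 1) ?K (pedges (rev [e, z, h, u]))"
            using H g z seK su hf' hg m n ef
            by (intro YD[of _ 4 _ _ "[f, g]" 1])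
              (auto simp: board_def saturated_insert doubleton_eq_iff)
          then show "win (2 * m + 1) (n - 1 - 1 - 1 - 1) ?K (insert {e, z} (pedges [z, h, u]))"
            unfolding pedges_rev by simp
          show "{e, z} \<notin> ?K" using z by blast
          show "{e, z} \<notin> pedges [z, h, u]" using H z by (intro not_in_pedges) auto
        qed (use m n z in auto)
      qed (use H sh m n in auto)
      then show "win (2 * m + 1) (n - 1 - 1) (insert {hd [h, u], g} ?H) (pedges [h, u])" by simp
    qed (use H m n in auto)
    have e: "insert {h, e} (pedges [h, u]) = pedges [e, h, u]" by (simp add: insert_commute)
    show "win (2 * m + 1) (n - 1) H (insert {h, e} (pedges [h, u]))"
      unfolding e
    proof (rule win_extend[of H "{f}"])
      fix g assume g: "g \<notin> \<Union>H" "g \<notin> set [e, h, u]" "g \<notin> {f}"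
      show "win (2 * m + 1) (n - 1 - 1) H (pedges [g, e, h, u])"
        using H g su m n by (intro XD[of _ 4 _ _ "[f]" 0]) (auto simp: board_def)
      have "saturated (insert {e, g} H) e"
        by (rule saturated_insert_half[OF H(6)]) (rule not_in_edges[OF g(1)])
      moreover have "half (insert {e, g} H) g" using g by (intro half_insert_new(2)) auto
      moreover have "half (insert {e, g} H) f" using H g by (intro half_insert_other) auto
      ultimately show "win (2 * m + 1) (n - 1 - 1) (insert {hd [e, h, u], g} H) (pedges [e, h, u])"
        using H g su m n
        by (intro YD[of _ 3 _ _ "[f, g]" 0]) (auto simp: board_def saturated_insert)
    qed (use H m n in auto)
  qed (use H hne m n in \<open>auto simp: doubleton_eq_iff\<close>)
qed

text \<open>With \<open>|H| + (V - 1) + n = 3 m + 3\<close>, the thresholds say \<open>V \<ge> 3 |H| + 2\<close> and \<open>V \<ge> 3 |H|\<close>,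
  respectively: a painter who refuses to saturate an end has to concede three green edges for
  every other edge.\<close>

definition free_path_wins :: "nat \<Rightarrow> nat \<Rightarrow> bool" where
  "free_path_wins m V \<longleftrightarrow> (\<forall>H p n. finite (\<Union>H) \<and> distinct p \<and> length p = V \<and> hd p \<notin> \<Union>H \<and>
     last p \<notin> \<Union>H \<and> 9 * m + 14 \<le> 3 * n + 4 * V \<longrightarrow> win (2 * m + 1) n H (pedges p))"

definition free_path_half_wins :: "nat \<Rightarrow> nat \<Rightarrow> bool" where
  "free_path_half_wins m V \<longleftrightarrow> (\<forall>H p e n. finite (\<Union>H) \<and> distinct (e # p) \<and> length p = V \<and> half H e \<and>
     hd p \<notin> \<Union>H \<and> last p \<notin> \<Union>H \<and> 9 * m + 12 \<le> 3 * n + 4 * V \<longrightarrow> win (2 * m + 1) n H (pedges p))"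

text \<open>The bound on \<open>n\<close> amounts to \<open>V \<ge> 3 |H| - 1\<close>. One more
  refusal saturates the head, which becomes the root by reversal with \<open>e\<close> and
  \<open>f\<close> in reserve; three vertices pay for this without debt, two are the case of
  \<open>win_short_path\<close>.\<close>

lemma half_end_path_step:
  assumes m: "8 \<le> m" and IH: "free_path_half_wins m (V + 1)"
    and H: "finite (\<Union>H)" "distinct (e # p)" "length p = V" "half H (hd p)" "half H e"
      "{hd p, e} \<in> H" "last p \<notin> \<Union>H"
    and V: "2 \<le> V" "V + 2 \<le> 2 * m" and n: "9 * m + 11 \<le> 3 * n + 4 * V"
  shows "win (2 * m + 1) n H (pedges p)"
proof -
  have "p \<noteq> []" using H(3) V by auto
  then have p: "p \<noteq> []" "hd p \<in> set p" "last p \<in> set p" "distinct p" "e \<notin> set p" using H(2) by auto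
  have n2: "2 \<le> n" using n V m by linarith
  show ?thesis
  proof (rule win_extend[of H "{e}"])
    fix f assume f: "f \<notin> \<Union>H" "f \<notin> set p" "f \<notin> {e}"
    show "win (2 * m + 1) (n - 1) H (pedges (f # p))"
      using IH[unfolded free_path_half_wins_def, rule_format, of H e "f # p" "n - 1"] H f p n n2
      by auto
    let ?H = "insert {hd p, f} H"
    have s: "saturated ?H (hd p)"
      by (rule saturated_insert_half[OF H(4)]) (rule not_in_edges[OF f(1)])
    have he: "half ?H e" using H(5) p f by (intro half_insert_other) auto
    have hf: "half ?H f" using p f by (intro half_insert_new(2)) auto
    have hl: "hd p \<noteq> last p" using half_in[OF H(4)] H(7) by auto
    have lf: "last p \<noteq> f" using p f by auto
    show "win (2 * m + 1) (n - 1) ?H (pedges p)"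
    proof (cases "V = 2")
      case True
      obtain h u where hu: "p = [u, h]"
        using H(3) True by (auto simp: numeral_eq_Suc length_Suc_conv)
      have "win (2 * m + 1) (n - 1) ?H (pedges [h, u])"
        using H f he hf hl n True m unfolding hu
        by (intro win_short_path[of _ _ _ _ e f]) auto
      then show ?thesis unfolding hu by (simp add: insert_commute)
    next
      case False
      have "board ?H (rev p) [e, f] 0"
        using H p f s he hf by (auto simp: board_def last_rev)
      moreover have "hd (rev p) \<notin> \<Union>?H" using p H(7) hl lf by (auto simp: hd_rev)
      ultimately have "win (2 * m + 1) (n - 1) ?H (pedges (rev p))"
        using H(3) V n n2 m False
        by (intro free_end_winsD[OF ends_win_below(2), of m V _ _ "[e, f]" 0]) auto
      then show ?thesis by (simp add: pedges_rev)
    qed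
  qed (use H p n2 in auto)
qed

lemma free_path_step:
  assumes m: "8 \<le> m" and IH: "free_path_wins m (V + 1)" "free_path_half_wins m (V + 1)"
    and V: "2 \<le> V" "V + 2 \<le> 2 * m"
  shows "free_path_wins m V"
  unfolding free_path_wins_def
proof (intro allI impI, elim conjE)
  fix H :: "nat set set" and p n
  assume H: "finite (\<Union>H)" "distinct p" "length p = V" "hd p \<notin> \<Union>H" "last p \<notin> \<Union>H"
    and n: "9 * m + 14 \<le> 3 * n + 4 * V"
  have "p \<noteq> []" using H(3) V by auto
  then have p: "p \<noteq> []" "hd p \<in> set p" "last p \<in> set p" by auto
  have hl: "hd p \<noteq> last p" using H(2,3) V by (cases p) (auto split: if_splits)
  have n2: "2 \<le> n" using n V m by linarith
  show "win (2 * m + 1) n H (pedges p)"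
  proof (rule win_extend[of H "{}"])
    fix e assume e: "e \<notin> \<Union>H" "e \<notin> set p"
    show "win (2 * m + 1) (n - 1) H (pedges (e # p))"
      using IH(1)[unfolded free_path_wins_def, rule_format, of H "e # p" "n - 1"] H e p n n2 by auto
    have "hd p \<noteq> e" "last p \<noteq> e" using e p by auto
    moreover have "half (insert {hd p, e} H) (hd p)" "half (insert {hd p, e} H) e"
      using half_insert_new(1)[OF H(4), of e] half_insert_new(2)[OF e(1), of "hd p"] calculation by auto
    ultimately show "win (2 * m + 1) (n - 1) (insert {hd p, e} H) (pedges p)"
      using H e p hl n n2 V by (intro half_end_path_step[OF m IH(2), of _ e]) auto
  qed (use H p n2 in auto)
qed

text \<open>A refused edge from the head to \<open>e\<close> saturates \<open>e\<close> while it is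
  still off the path, and forced edges then attach it as a root. If the edge is green,
  \<open>e\<close> is the new head, and a single refusal there makes it the root.\<close>

lemma free_path_half_step:
  assumes m: "8 \<le> m" and IH: "free_path_wins m (V + 2)"
    and V: "3 \<le> V" "V + 1 \<le> 2 * m"
  shows "free_path_half_wins m V"
  unfolding free_path_half_wins_def
proof (intro allI impI, elim conjE)
  fix H p e n
  assume H: "finite (\<Union>H)" "distinct (e # p)" "length p = V" "half H e" "hd p \<notin> \<Union>H" "last p \<notin> \<Union>H"
    and n: "9 * m + 12 \<le> 3 * n + 4 * V"
  note YD = saturated_end_winsD[OF ends_win_below(1)] and XD = free_end_winsD
  have X: "free_end_wins m W" if "W \<le> 2 * m + 1" for W
    using that ends_win_below(2)[of m W] free_end_wins_top[of m] m by (cases "W = 2 * m + 1") auto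
  have "p \<noteq> []" using H(3) V by auto
  then have p: "p \<noteq> []" "hd p \<in> set p" "last p \<in> set p" "distinct p" "e \<notin> set p" using H(2) by auto
  have hl: "hd p \<noteq> last p" using p(4) H(3) V by (cases p) (auto split: if_splits)
  have he: "hd p \<noteq> e" "last p \<noteq> e" using p by auto
  have nH: "{hd p, e} \<notin> H" using H(5) by blast
  have n5: "5 \<le> n" using n V m by linarith
  show "win (2 * m + 1) n H (pedges p)"
  proof (rule win_moveI[of n "hd p" e])
    let ?H = "insert {hd p, e} H"
    have se: "saturated ?H e"
      using saturated_insert_half(2)[OF H(4), of "hd p"] nH by (simp add: insert_commute)
    have hh: "half ?H (hd p)" by (rule half_insert_new(1)[OF H(5) he(1)])
    show "win (2 * m + 1) (n - 1) ?H (pedges p)"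
    proof (rule win_extend[of ?H "{e}"])
      fix g assume g: "g \<notin> \<Union>?H" "g \<notin> set p" "g \<notin> {e}"
      show "win (2 * m + 1) (n - 1 - 1) ?H (pedges (g # p))"
      proof (rule win_forcedI[OF _ se, of _ g])
        have "board ?H (rev (e # g # p)) [] 0" using H p g se by (auto simp: board_def)
        moreover have "hd (rev (e # g # p)) \<notin> \<Union>?H" using p H(6) hl he by (auto simp: hd_append hd_rev)
        ultimately have "win (2 * m + 1) (n - 1 - 1 - 1) ?H (pedges (rev (e # g # p)))"
          using H(3) V n n5 by (intro XD[OF X, of "V + 2" _ _ "[]" 0]) auto
        then show "win (2 * m + 1) (n - 1 - 1 - 1) ?H (insert {e, g} (pedges (g # p)))"
          unfolding pedges_rev by simp
        show "{e, g} \<notin> ?H" using g by blast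
        show "{e, g} \<notin> pedges (g # p)" using p g by (intro not_in_pedges) auto
      qed (use n5 g in auto)
      let ?K = "insert {hd p, g} ?H"
      have sh: "saturated ?K (hd p)"
        by (rule saturated_insert_half[OF hh]) (rule not_in_edges[OF g(1)])
      have seK: "saturated ?K e" using se by (rule saturated_insert)
      have hg: "half ?K g" using g by (intro half_insert_new(2)) auto
      have lg: "last p \<noteq> g" using p g by auto
      show "win (2 * m + 1) (n - 1 - 1) ?K (pedges p)"
      \<comment> \<open>Joined to the head in \<open>H\<close>, \<open>e\<close> is attached to the
        untouched far end instead.\<close>
      proof (rule win_forcedI[OF _ seK, of _ "last p"])
        have "board ?K (p @ [e]) [g] 0" using H p g seK hg by (auto simp: board_def)
        moreover have "hd (p @ [e]) = hd p" using p by simp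
        ultimately have "win (2 * m + 1) (n - 1 - 1 - 1) ?K (pedges (p @ [e]))"
          using H(3) V n n5 m sh by (intro YD[of m "V + 1" _ _ "[g]" 0]) auto
        then show "win (2 * m + 1) (n - 1 - 1 - 1) ?K (insert {e, last p} (pedges p))"
          using p by (simp add: pedges_snoc insert_commute)
        show "{e, last p} \<notin> ?K" using H(6) hl he lg g by (auto simp: doubleton_eq_iff)
        show "{e, last p} \<notin> pedges p" using p by (intro not_in_pedges) auto
      qed (use n5 he in auto)
    qed (use n5 H p in auto)
    have e: "insert {hd p, e} (pedges p) = pedges (e # p)"
      using p by (simp add: pedges_Cons insert_commute)
    show "win (2 * m + 1) (n - 1) H (insert {hd p, e} (pedges p))"
      unfolding e
    proof (rule win_extend[of H "{}"])
      fix g assume g: "g \<notin> \<Union>H" "g \<notin> set (e # p)"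
      show "win (2 * m + 1) (n - 1 - 1) H (pedges (g # e # p))"
        using IH[unfolded free_path_wins_def, rule_format, of H "g # e # p" "n - 1 - 1"] H g p n n5
        by auto
      let ?K = "insert {e, g} H"
      have "saturated ?K e"
        by (rule saturated_insert_half[OF H(4)]) (rule not_in_edges[OF g(1)])
      moreover have "half ?K g" using g by (intro half_insert_new(2)) auto
      ultimately have "board ?K (rev (e # p)) [g] 0" using H p g by (auto simp: board_def)
      moreover have "hd (rev (e # p)) \<notin> \<Union>?K" using p H(6) he g by (auto simp: hd_append hd_rev)
      ultimately have "win (2 * m + 1) (n - 1 - 1) ?K (pedges (rev (e # p)))"
        using H(3) V n n5 by (intro XD[OF X, of "V + 1" _ _ "[g]" 0]) auto
      then show "win (2 * m + 1) (n - 1 - 1) (insert {hd (e # p), g} H) (pedges (e # p))"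
        unfolding pedges_rev by simp
    qed (use n5 H p in auto)
  qed (use n5 nH he p not_in_pedges(2)[OF p(5)] in auto)
qed

lemma free_path_wins_below:
  assumes m: "8 \<le> m" and "2 \<le> V" "V \<le> 2 * m + 1"
  shows "free_path_wins m V"
  using assms(2,3)
proof (induction "2 * m + 1 - V" arbitrary: V rule: less_induct)
  case less
  \<comment> \<open>Here \<open>m \<ge> 8\<close> matters: the threshold leaves at least 6, 8 and 9
    rounds in the first three cases, whose endgames take 5, 7 and 9.\<close>
  consider "V = 2 * m + 1" | "V = 2 * m" | "V + 1 = 2 * m" | "V + 2 \<le> 2 * m"
    using less.prems by linarith
  then show ?case
  proof cases
    case 1
    then show ?thesis using m unfolding free_path_wins_def by (auto intro!: win_free_path_missing_0)
  next
    case 2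
    then show ?thesis using m unfolding free_path_wins_def by (auto intro!: win_free_path_missing_1)
  next
    case 3
    then show ?thesis using m unfolding free_path_wins_def
      by (auto intro!: win_free_path_missing_2)
  next
    case 4
    then have IH: "free_path_wins m (V + 1)" "free_path_wins m (V + 1 + 2)"
      using less.hyps less.prems by auto
    have "free_path_half_wins m (V + 1)"
      using free_path_half_step[OF m IH(2)] less.prems 4 by simp
    then show ?thesis using free_path_step[OF m IH(1)] less.prems 4 by simp
  qed
qed

text \<open>The opening has no slack: a green first edge, a refusal followed by green, and two
  refusals all meet their thresholds with equality.\<close>

lemma win_empty:
  assumes m: "8 \<le> m"
  shows "win (2 * m + 1) (3 * m + 3) {} {}"
proof (rule win_moveI[of _ "0::nat" 1])
  show "win (2 * m + 1) (3 * m + 3 - 1) {} (insert {0, 1} {})"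
    using free_path_wins_below[of m 2, unfolded free_path_wins_def, rule_format,
        of "{}" "[0, 1]" "3 * m + 2"] m by simp
  let ?H = "{{0, 1}} :: nat set set"
  have "win (2 * m + 1) (3 * m + 2) ?H (pedges [0])"
  proof (rule win_extend[of ?H "{}"])
    fix z assume z: "z \<notin> \<Union>?H"
    have "half ?H 0" "half ?H 1"
      using half_insert_new[of 0 "{}" 1] half_insert_new[of 1 "{}" 0] by auto
    then have "win (2 * m + 1) (3 * m + 1) ?H (pedges [0, z])"
      using m z by (intro half_end_path_step[of m 2 _ 1] free_path_half_step free_path_wins_below) auto
    then show "win (2 * m + 1) (3 * m + 2 - 1) ?H (pedges [z, 0])" by (simp add: insert_commute)
    let ?K = "insert {0, z} ?H"
    have "saturated ?K 0"
      unfolding saturated_def using z by (intro exI[of _ z] exI[of _ 1]) auto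
    moreover have "half ?K z" using z by (intro half_insert_new(2)) auto
    moreover have "half ?K 1" by (rule half_insert_other[OF \<open>half ?H 1\<close>]) (use z in auto)
    \<comment> \<open>The vertex \<open>0\<close> is both head and root, and both reserve vertices
      are joined to it, so the debt has to be 0.\<close>
    ultimately show "win (2 * m + 1) (3 * m + 2 - 1) (insert {hd [0], z} ?H) (pedges [0])"
      using z m
      by (intro saturated_end_winsD[OF ends_win_below(1), of m 1 _ _ "[1, z]" 0])
        (auto simp: board_def)
  qed auto
  then show "win (2 * m + 1) (3 * m + 3 - 1) (insert {0, 1} {}) {}" by simp
qed auto

section \<open>From the color-blind game to the three-color game\<close>

text \<open>Backward induction, as a link between the inductive \<open>win\<close> and strategies
  given as functions of the position.\<close>

primrec builder_forces :: "'a graph \<Rightarrow> 'b graph \<Rightarrow> 'c graph \<Rightarrow> nat \<Rightarrow> position \<Rightarrow> bool" where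
  "builder_forces G1 G2 G3 0 h \<longleftrightarrow> builder_won G1 G2 G3 h"
| "builder_forces G1 G2 G3 (Suc n) h \<longleftrightarrow> builder_won G1 G2 G3 h \<or>
     (\<exists>u v. u \<noteq> v \<and> {u, v} \<notin> fst ` set h \<and> (\<forall>c. builder_forces G1 G2 G3 n (h @ [({u, v}, c)])))"

lemma builder_won_forces: "builder_won G1 G2 G3 h \<Longrightarrow> builder_forces G1 G2 G3 n h"
  by (cases n) auto

lemma length_play: "length (play B P n) = n"
  by (induction n) (auto simp: Let_def)

text \<open>A strategy sees only the position, so the number of rounds left is read off from the
  length of the history.\<close>

lemma builder_wins_withinI:
  assumes "builder_forces G1 G2 G3 n []"
  shows "builder_wins_within G1 G2 G3 n"
proof -
  define legal :: "position \<Rightarrow> nat set \<Rightarrow> bool"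
    where "legal h e \<longleftrightarrow> (\<exists>u v. u \<noteq> v \<and> e = {u, v}) \<and> e \<notin> fst ` set h" for h e
  define good where "good h e \<longleftrightarrow> legal h e \<and>
    (\<forall>c. builder_forces G1 G2 G3 (n - Suc (length h)) (h @ [(e, c)]))" for h e
  \<comment> \<open>The second choice is a default that keeps the strategy legal at positions
    without a good move.\<close>
  define B where "B h = (if \<exists>e. good h e then SOME e. good h e else SOME e. legal h e)" for h
  have ex: "\<exists>e. legal h e" for h
  proof -
    have inj: "inj (\<lambda>i::nat. {0, Suc i})" by (auto simp: inj_def doubleton_eq_iff)
    have "infinite (range (\<lambda>i::nat. {0, Suc i}))" using inj by (rule range_inj_infinite)
    then obtain e where "e \<in> range (\<lambda>i::nat. {0, Suc i})" "e \<notin> fst ` set h"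
      by (meson List.finite_set finite_imageI finite_subset subsetI)
    then show ?thesis unfolding legal_def by blast
  qed
  have good_B: "good h (B h)" if "\<exists>e. good h e" for h
    using someI_ex[OF that] that by (simp add: B_def)
  have leg: "legal h (B h)" for h
  proof (cases "\<exists>e. good h e")
    case True
    then show ?thesis using good_B unfolding good_def by blast
  next
    case False
    then show ?thesis unfolding B_def using someI_ex[OF ex[of h]] by auto
  qed
  \<comment> \<open>Play continues after a win, so the invariant has to remember earlier
    wins.\<close>
  have forces: "(\<exists>m\<le>i. builder_won G1 G2 G3 (play B P m)) \<or> builder_forces G1 G2 G3 (n - i) (play B P i)"
    if "i \<le> n" for P i
    using that
  proof (induction i)
    case 0
    then show ?case using assms by simp
  next
    case (Suc i)
    let ?h = "play B P i"
    show ?case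
    proof (cases "\<exists>m\<le>i. builder_won G1 G2 G3 (play B P m)")
      case True
      then show ?thesis using le_SucI by blast
    next
      case False
      then have "builder_forces G1 G2 G3 (n - i) ?h" using Suc.IH Suc.prems by auto
      moreover have "n - i = Suc (n - Suc i)" using Suc.prems by arith
      ultimately obtain u v where "u \<noteq> v" "{u, v} \<notin> fst ` set ?h"
        "\<forall>c. builder_forces G1 G2 G3 (n - Suc i) (?h @ [({u, v}, c)])"
        using False by auto
      then have "\<exists>e. good ?h e"
        unfolding good_def legal_def length_play by (intro exI[of _ "{u, v}"]) blast
      then have "good ?h (B ?h)" by (rule good_B)
      then show ?thesis unfolding good_def length_play by (simp add: Let_def)
    qed
  qed
  have "\<exists>m\<le>n. builder_won G1 G2 G3 (play B P m)" for P
    using forces[of n P] by auto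
  moreover have "legal_builder B" using leg unfolding legal_builder_def legal_def by blast
  ultimately show ?thesis unfolding builder_wins_within_def by blast
qed

lemma contains_path_3:
  assumes "{v, a} \<in> F" "{v, b} \<in> F" "a \<noteq> b" "v \<noteq> a" "v \<noteq> b"
  shows "contains_copy F (path_graph 3)"
proof -
  define f where "f i = (if i = 0 then a else if i = 1 then v else b)" for i :: nat
  have "inj_on f {..<3}" using assms by (auto simp: inj_on_def f_def)
  moreover have "f ` e \<in> F" if "e \<in> {{i, Suc i} |i. Suc i < 3}" for e
  proof -
    from that obtain i where "e = {i, Suc i}" "i = 0 \<or> i = 1" by fastforce
    then show ?thesis using assms by (auto simp: f_def insert_commute)
  qed
  ultimately show ?thesis unfolding contains_copy_def path_graph_def by auto
qed

lemma color_class_snoc: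
  "color_class (h @ [(e, c)]) d = (if d = c then insert e (color_class h d) else color_class h d)"
  by (auto simp: color_class_def)

lemma color_classes_cover:
  "fst ` set h = color_class h Red \<union> color_class h Blue \<union> color_class h Green"
proof (intro equalityI subsetI)
  fix e assume "e \<in> fst ` set h"
  then obtain c where "(e, c) \<in> set h" by auto
  then show "e \<in> color_class h Red \<union> color_class h Blue \<union> color_class h Green"
    by (cases c) (auto simp: color_class_def)
qed (auto simp: color_class_def intro: rev_image_eqI)

text \<open>By pigeonhole two edges of a \<open>star\<close> share a color and form a monochromatic
  path; in a \<open>move\<close>, red and blue answers lead to the same color-blind
  position.\<close>

lemma win_builder_forces:
  assumes "win l n H G" "\<forall>e\<in>fst ` set h. \<exists>u v. u \<noteq> v \<and> e = {u, v}"
    "color_class h Red \<union> color_class h Blue = H" "color_class h Green = G"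
  shows "builder_forces (path_graph 3) (path_graph 3) (cycle_graph l) n h"
  using assms
proof (induction arbitrary: h rule: win.induct)
  case (star a b c v H n G)
  \<comment> \<open>Loops \<open>{v, v}\<close> must be excluded before \<open>v\<close> can be the
    middle of a path on three vertices.\<close>
  have ne: "v \<noteq> x" if "{v, x} \<in> H" for x
  proof -
    have "{v, x} \<in> fst ` set h" using that star.prems(2) unfolding color_classes_cover by blast
    then obtain y z where "y \<noteq> z" "{v, x} = {y, z}" using star.prems(1) by blast
    then show ?thesis by (auto simp: doubleton_eq_iff)
  qed
  have P3: "contains_copy F (path_graph 3)" if "{v, x} \<in> F" "{v, y} \<in> F" "x \<noteq> y" "F \<subseteq> H" for F x y
    using that ne by (intro contains_path_3[of v x F y]) auto
  have "({v, a} \<in> F \<and> {v, b} \<in> F) \<or> ({v, a} \<in> F \<and> {v, c} \<in> F) \<or> ({v, b} \<in> F \<and> {v, c} \<in> F)"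
    if "F = color_class h Red \<and> \<not> contains_copy (color_class h Blue) (path_graph 3)" for F
    using that star.hyps star.prems(2) P3[of _ "color_class h Blue"] by blast
  then have "builder_won (path_graph 3) (path_graph 3) (cycle_graph l) h"
    unfolding builder_won_def using star.hyps star.prems(2) P3[of _ "color_class h Red"] by blast
  then show ?case by (rule builder_won_forces)
next
  case (cycle G n H)
  then show ?case by (intro builder_won_forces) (simp add: builder_won_def)
next
  case (move u v H G n)
  have "builder_forces (path_graph 3) (path_graph 3) (cycle_graph l) n (h @ [({u, v}, c)])" for c
  proof -
    have ok: "\<forall>e\<in>fst ` set (h @ [({u, v}, c)]). \<exists>x y. x \<noteq> y \<and> e = {x, y}"
      using move.prems(1) move.hyps(1) unfolding set_append image_Un ball_Un by simp blast
    show ?thesis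
    proof (cases c)
      case Green
      then show ?thesis using move.prems(2,3) by (intro move.IH(2) ok) (simp_all add: color_class_snoc)
    qed (use move.prems(2,3) in \<open>intro move.IH(1) ok; simp add: color_class_snoc\<close>)+
  qed
  moreover have "{u, v} \<notin> fst ` set h"
    using move.hyps move.prems unfolding color_classes_cover by auto
  ultimately show ?case using move.hyps(1) by auto
qed

theorem theorem4p13:
  fixes k :: nat
  assumes "k \<ge> 4"
  shows "online_ramsey (path_graph 3) (path_graph 3) (cycle_graph (4 * k + 1)) \<le> enat (6 * k + 3)"
proof -
  \<comment> \<open>The color-blind game is instantiated with \<open>m = 2 * k\<close>.\<close>
  have "win (4 * k + 1) (6 * k + 3) {} {}"
    using win_empty[of "2 * k"] assms by (simp add: mult.assoc)
  then have "builder_wins_within (path_graph 3) (path_graph 3) (cycle_graph (4 * k + 1)) (6 * k + 3)"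
    by (intro builder_wins_withinI win_builder_forces) (auto simp: color_class_def)
  then show ?thesis unfolding online_ramsey_def by (intro Inf_lower) blast
qed

end
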